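(* (i) $E(\mathtt{0x01},\mathtt{0x04})=E(\mathtt{0x04},\mathtt{0x01})$, and $E(\mathtt{0x28},\mathtt{0x79})=E(\mathtt{0x79},\mathtt{0x28})$ (the latter common value being the string $2^9$ of nine symbols $2$); hence $E$ is not injective, even on messages of equal length, and for every function $\Phi$ on strings the hash $\Phi\circ E$ takes the same value on the two members of each pair. (ii) $E(\mathtt{0x01},\mathtt{0x01})=E(\mathtt{0x04})$. (iii) For a nonzero byte $b$ there exist nonzero bytes $b_1,b_2$ with $E(b_1,b_2)=E(b)$ if and only if $b$ is not of the form $d\cdot 3^j$ with $d\in\{1,2\}$ and $j\ge0$. Exactly $11$ nonzero bytes have this form, so exactly $244$ of the $255$ nonzero bytes, regarded as one-byte messages, have such a two-byte second preimage under $\Phi\circ E$, for every $\Phi$. (iv) For every $r\ge1$ there are $2^r$ distinct messages of equal length $2r$, obtained by choosing independently in each of $r$ two-byte positions either $(\mathtt{0x28},\mathtt{0x79})$ or $(\mathtt{0x79},\mathtt{0x28})$, all having the same value of $E$, hence the same value of $\Phi\circ E$. (v) If $M_0,M_1$ are messages with $E(M_0)=E(M_1)$, then for all byte strings $P,T$ and every $\Phi$, with $h=\Phi\circ E$, one has $h(P\|T\|M_0)=h(P\|T\|M_1)$.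
   Context: For a nonzero byte $b\in\{1,\dots,255\}$, write $b$ in base $3$ without leading zeros as a string of trits and replace each trit $\tau\in\{0,1,2\}$ by $\tau+1\in\{1,2,3\}$; the resulting string over $\{1,2,3\}$ is the codeword $C(b)$. A fixed string $C(0)$ over $\{1,2,3\}$ is assigned to the zero byte; its choice is irrelevant to the claim. For a message (byte string) $M=(b_1,\dots,b_m)$ put $E(M)=C(b_1)\|\cdots\|C(b_m)$, the concatenation of strings. The hash function under study has the form $\Phi\circ E$, where $\Phi$ maps strings over $\{1,2,3\}$ to digests (by a walk on a Cayley graph of $\mathrm{SL}_4(\mathbb F_p)$, the details of which are not needed). *)

theory Defs
  imports "HOL-Library.Word"
begin

type_synonym byte = "8 word"

(* Base-3 digits, most significant first, no leading zeros (the empty list for 0). *)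
fun base3 :: "nat \<Rightarrow> nat list" where
  "base3 n = (if n = 0 then [] else base3 (n div 3) @ [n mod 3])"

declare base3.simps [simp del]

(* The parameter C0 is the codeword C(0) of the zero byte. *)
definition codeword :: "nat list \<Rightarrow> byte \<Rightarrow> nat list" where
  "codeword C0 b = (if b = 0 then C0 else map (\<lambda>t. t + 1) (base3 (unat b)))"

definition encode :: "nat list \<Rightarrow> byte list \<Rightarrow> nat list" where
  "encode C0 M = concat (map (codeword C0) M)"

definition second_preimage :: "('m \<Rightarrow> 'd) \<Rightarrow> 'm \<Rightarrow> 'm \<Rightarrow> bool" where
  "second_preimage h x y \<longleftrightarrow> y \<noteq> x \<and> h y = h x"

definition swap_messages :: "nat \<Rightarrow> byte list set" where
  "swap_messages r =
     concat ` {ps. length ps = r \<and> set ps \<subseteq> {[0x28, 0x79], [0x79, 0x28]}}"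

(* Encodings are strings over {1,2,3}, so it is harmless that a function on such strings
   is represented by a function on all of nat list. *)
lemma set_encode_subset:
  assumes "set C0 \<subseteq> {1, 2, 3}"
  shows "set (encode C0 M) \<subseteq> {1, 2, 3}"
proof -
  have digits: "set (base3 n) \<subseteq> {0, 1, 2}" for n
  proof (induction n rule: base3.induct)
    case (1 n)
    have "n mod 3 \<in> {0, 1, 2}" by auto
    with 1 show ?case by (subst base3.simps) auto
  qed
  have "set (codeword C0 b) \<subseteq> {1, 2, 3}" for b
  proof (cases "b = 0")
    case True
    with assms show ?thesis by (simp add: codeword_def)
  next
    case False
    then have "set (codeword C0 b) = Suc ` set (base3 (unat b))"
      by (simp add: codeword_def)
    also have "\<dots> \<subseteq> Suc ` {0, 1, 2}"
      by (rule image_mono) (rule digits)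
    finally show ?thesis by (simp add: eval_nat_numeral)
  qed
  then show ?thesis by (fastforce simp: encode_def)
qed

end

(* The digit string of a nonzero byte splits into two digit strings of nonzero numbers exactly
   when some digit after the leading one is nonzero: cut in front of the first such digit. The
   numbers whose only nonzero digit is the leading one are those of the form d * 3 ^ j. The message
   (0x28, 0x79) reads 1111|11111 in base 3, so its two bytes commute under the encoding. *)
theory Submission
  imports Defs
begin

section \<open>Ternary numerals and their values\<close>

text \<open>Horner evaluation from the left: a digit appended on the right acts as in the recursion
  of \<open>base3\<close>. Arbitrary lists are allowed, including leading zeros and digits above
  2.\<close>

definition base3_val :: "nat list \<Rightarrow> nat" where
  "base3_val = foldl (\<lambda>v d. 3 * v + d) 0"

lemma base3_val_Nil [simp]: "base3_val [] = 0"
  by (simp add: base3_val_def)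

lemma base3_val_snoc [simp]: "base3_val (ds @ [d]) = 3 * base3_val ds + d"
  by (simp add: base3_val_def)

lemma base3_val_single [simp]: "base3_val [d] = d"
  using base3_val_snoc[of "[]" d] by simp

lemma base3_val_append: "base3_val (xs @ ys) = base3_val xs * 3 ^ length ys + base3_val ys"
proof (induction ys rule: rev_induct)
  case (snoc y ys)
  then show ?case
    by (simp flip: append_assoc)
qed simp

lemma base3_val_Cons: "base3_val (d # ds) = d * 3 ^ length ds + base3_val ds"
  using base3_val_append[of "[d]" ds] by simp

lemma base3_val_replicate_0 [simp]: "base3_val (replicate j 0) = 0"
  by (induction j) (simp_all add: base3_val_Cons)

lemma base3_0 [simp]: "base3 0 = []"
  by (simp add: base3.simps)

lemma base3_eq_Nil_iff [simp]: "base3 n = [] \<longleftrightarrow> n = 0"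
  by (subst base3.simps) simp

lemma base3_val_base3 [simp]: "base3_val (base3 n) = n"
proof (induction n rule: base3.induct)
  case (1 n)
  then show ?case
    by (subst base3.simps) simp
qed

lemma set_base3_subset: "set (base3 n) \<subseteq> {..<3}"
proof (induction n rule: base3.induct)
  case (1 n)
  then show ?case
    by (subst base3.simps) auto
qed

text \<open>Division by 3 strips digits from the right until a single digit is left; that digit is
  the remaining number itself, still nonzero.\<close>

lemma hd_base3_neq_0: "n \<noteq> 0 \<Longrightarrow> hd (base3 n) \<noteq> 0"
proof (induction n rule: base3.induct)
  case (1 n)
  show ?case
  proof (cases "n div 3 = 0")
    case True
    with 1(2) show ?thesis by (subst base3.simps) (simp add: div_eq_0_iff)
  next
    case False
    with 1 show ?thesis by (subst base3.simps) (simp add: hd_append)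
  qed
qed

text \<open>Uniqueness of numerals: a list without leading zero and with digits below 3 is recovered
  from its value, since the last digit is the remainder mod 3 and the rest is again such a list. The
  empty list stands for 0.\<close>

lemma base3_base3_val:
  assumes "ds \<noteq> [] \<Longrightarrow> hd ds \<noteq> 0" "set ds \<subseteq> {..<3}"
  shows "base3 (base3_val ds) = ds"
  using assms
proof (induction ds rule: rev_induct)
  case (snoc d ds)
  have IH: "base3 (base3_val ds) = ds"
    using snoc by (cases "ds = []") (simp_all add: hd_append)
  \<comment> \<open>This excludes the case in which \<open>base3\<close> returns the empty list. If
    \<open>ds\<close> is empty, \<open>d\<close> is the leading digit; otherwise a zero value of
    \<open>ds\<close> would contradict the induction hypothesis.\<close>
  have "3 * base3_val ds + d \<noteq> 0"
  proof (cases "ds = []")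
    case False
    then have "base3_val ds \<noteq> 0"
      using IH base3_eq_Nil_iff by metis
    then show ?thesis by simp
  qed (use snoc in simp)
  moreover have "(3 * base3_val ds + d) div 3 = base3_val ds" "(3 * base3_val ds + d) mod 3 = d"
    using snoc.prems by auto
  ultimately show ?case
    using IH by (subst base3.simps) simp
qed simp

section \<open>Cutting a numeral into two numerals\<close>

lemma base3_split_iff:
  assumes "n \<noteq> 0"
  shows "(\<exists>a b. a \<noteq> 0 \<and> b \<noteq> 0 \<and> base3 a @ base3 b = base3 n) \<longleftrightarrow>
    \<not> (\<exists>d\<in>{1, 2}. \<exists>j. n = d * 3 ^ j)"
proof
  assume "\<exists>a b. a \<noteq> 0 \<and> b \<noteq> 0 \<and> base3 a @ base3 b = base3 n"
  then obtain a b where ab: "a \<noteq> 0" "b \<noteq> 0" "base3 a @ base3 b = base3 n"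
    by blast
  show "\<not> (\<exists>d\<in>{1, 2}. \<exists>j. n = d * 3 ^ j)"
  proof
    assume "\<exists>d\<in>{1, 2}. \<exists>j. n = d * 3 ^ j"
    then obtain d j where d: "d \<in> {1, 2}" and n: "n = d * 3 ^ j"
      by blast
    have "base3 (base3_val (d # replicate j 0)) = d # replicate j 0"
      by (rule base3_base3_val) (use d in auto)
    then have "base3 a @ base3 b = d # replicate j 0"
      using ab(3) n by (simp add: base3_val_Cons)
    \<comment> \<open>The nonempty \<open>base3 a\<close> absorbs the leading \<open>d\<close>, so
      \<open>base3 b\<close> is a suffix of the zeros and its leading digit would be 0.\<close>
    then obtain ys where "ys @ base3 b = replicate j 0"
      using ab(1) by (auto simp: append_eq_Cons_conv)
    then have "set (base3 b) \<subseteq> set (replicate j 0)"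
      by (metis Un_upper2 set_append)
    then have "hd (base3 b) = 0"
      using ab(2) hd_in_set[of "base3 b"] base3_eq_Nil_iff[of b]
      by (metis in_mono in_set_replicate)
    then show False
      using hd_base3_neq_0[OF ab(2)] by simp
  qed
next
  assume notpow: "\<not> (\<exists>d\<in>{1, 2}. \<exists>j. n = d * 3 ^ j)"
  obtain d ds where dds: "base3 n = d # ds"
    using assms by (metis base3_eq_Nil_iff neq_Nil_conv)
  have d: "d \<in> {1, 2}"
    using hd_base3_neq_0[OF assms] set_base3_subset[of n] unfolding dds by auto
  have "\<exists>e\<in>set ds. e \<noteq> 0"
  proof (rule ccontr)
    assume "\<not> (\<exists>e\<in>set ds. e \<noteq> 0)"
    then have "ds = replicate (length ds) 0"
      by (metis replicate_length_same)
    then have "n = d * 3 ^ length ds"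
      using base3_val_base3[of n] base3_val_Cons[of d ds] base3_val_replicate_0 unfolding dds
      by (metis add_0_right)
    with d notpow show False
      by blast
  qed
  \<comment> \<open>Any nonzero digit behind the leading one can serve as the cut point:
    \<open>d # zs\<close> and \<open>e # es\<close> then both start with a nonzero digit and are
    genuine numerals.\<close>
  then obtain zs e es where ds: "ds = zs @ e # es" and e: "e \<noteq> 0"
    by (meson split_list)
  define a where "a = base3_val (d # zs)"
  define b where "b = base3_val (e # es)"
  have digits: "set (d # zs) \<subseteq> {..<3}" "set (e # es) \<subseteq> {..<3}"
    using set_base3_subset[of n] unfolding dds ds by auto
  have a: "base3 a = d # zs"
    unfolding a_def using d digits by (intro base3_base3_val) auto
  have b: "base3 b = e # es"
    unfolding b_def using e digits by (intro base3_base3_val) auto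
  have "a \<noteq> 0" "b \<noteq> 0" "base3 a @ base3 b = base3 n"
    using a b dds ds base3_eq_Nil_iff[of a] base3_eq_Nil_iff[of b]
    by (simp_all del: base3_eq_Nil_iff)
  then show "\<exists>a b. a \<noteq> 0 \<and> b \<noteq> 0 \<and> base3 a @ base3 b = base3 n"
    by blast
qed

text \<open>Ensures that the two parts of a byte's numeral are again values of bytes.\<close>

lemma base3_split_le:
  assumes "base3 a @ base3 b = base3 n"
  shows "a \<le> n" "b \<le> n"
proof -
  have "n = a * 3 ^ length (base3 b) + b"
    using base3_val_append[of "base3 a" "base3 b"] assms by simp
  moreover have "a \<le> a * 3 ^ length (base3 b)"
    by simp
  ultimately show "a \<le> n" "b \<le> n"
    by linarith+
qed

section \<open>From numerals to codewords of bytes\<close>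

lemma unat_byte_less: "unat (b :: byte) < 256"
  using unsigned_less[of b] by simp

lemma encode_Nil [simp]: "encode C0 [] = []"
  by (simp add: encode_def)

lemma encode_Cons: "encode C0 (b # M) = codeword C0 b @ encode C0 M"
  by (simp add: encode_def)

lemma encode_append [simp]: "encode C0 (M @ N) = encode C0 M @ encode C0 N"
  by (simp add: encode_def)

lemma map_add1_eq_iff: "map (\<lambda>t. t + 1) xs = map (\<lambda>t. t + 1) ys \<longleftrightarrow> xs = (ys :: nat list)"
  by (intro inj_map_eq_map) (simp add: inj_def)

text \<open>Adding 1 to every digit is injective and commutes with concatenation, so for nonzero
  bytes codewords can be compared through their numerals.\<close>

lemma encode_pair_eq_iff:
  assumes "b1 \<noteq> 0" "b2 \<noteq> 0" "b \<noteq> 0"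
  shows "encode C0 [b1, b2] = encode C0 [b] \<longleftrightarrow>
    base3 (unat b1) @ base3 (unat b2) = base3 (unat b)"
  using assms map_add1_eq_iff[of "base3 (unat b1) @ base3 (unat b2)" "base3 (unat b)"]
  by (simp add: encode_Cons codeword_def)

lemma encode_split_iff:
  assumes "b \<noteq> 0"
  shows "(\<exists>b1 b2. b1 \<noteq> 0 \<and> b2 \<noteq> 0 \<and> encode C0 [b1, b2] = encode C0 [b]) \<longleftrightarrow>
    \<not> (\<exists>d\<in>{1, 2}. \<exists>j. unat b = d * 3 ^ j)" (is "?L \<longleftrightarrow> _")
proof -
  have nz: "unat b \<noteq> 0"
    using assms by (simp add: unat_eq_0)
  have "?L \<longleftrightarrow> (\<exists>m n. m \<noteq> 0 \<and> n \<noteq> 0 \<and> base3 m @ base3 n = base3 (unat b))"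
  proof
    assume ?L
    then show "\<exists>m n. m \<noteq> 0 \<and> n \<noteq> 0 \<and> base3 m @ base3 n = base3 (unat b)"
      using assms by (metis encode_pair_eq_iff unat_eq_0)
  next
    assume "\<exists>m n. m \<noteq> 0 \<and> n \<noteq> 0 \<and> base3 m @ base3 n = base3 (unat b)"
    then obtain m n where mn: "m \<noteq> 0" "n \<noteq> 0" "base3 m @ base3 n = base3 (unat b)"
      by blast
    \<comment> \<open>Both parts fit into 8 bits, so the conversion to bytes does not wrap
      around.\<close>
    have "m < 256" "n < 256"
      using base3_split_le[OF mn(3)] unat_byte_less[of b] by simp_all
    then have "unat (of_nat m :: byte) = m" "unat (of_nat n :: byte) = n"
      by (simp_all add: unat_of_nat)
    then show ?L
      using mn assms by (metis encode_pair_eq_iff unat_0)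
  qed
  then show ?thesis
    using base3_split_iff[OF nz] by simp
qed

section \<open>Counting the splittable bytes\<close>

lemma nonzero_bytes_card: "card {b :: byte. b \<noteq> 0} = 255"
proof -
  have "{b :: byte. b \<noteq> 0} = UNIV - {0}"
    by auto
  then show ?thesis
    by (simp add: card_Diff_singleton card_word)
qed

text \<open>The six powers of 3 up to 243 and the five doubled powers up to 162 are below
  256.\<close>

lemma unsplittable_bytes_card:
  "card {b :: byte. b \<noteq> 0 \<and> (\<exists>d\<in>{1, 2}. \<exists>j. unat b = d * 3 ^ j)} = 11" (is "card ?S = 11")
proof -
  let ?N = "{1, 3, 9, 27, 81, 243, 2, 6, 18, 54, 162} :: nat set"
  have "unat ` ?S = ?N"
  proof (intro equalityI subsetI)
    fix n assume "n \<in> unat ` ?S"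
    then obtain b :: byte and d j where d: "d \<in> {1, 2}" and n: "n = d * 3 ^ j" "n = unat b"
      by blast
    \<comment> \<open>Bounding \<open>j\<close> leaves a finite check: \<open>3 ^ 6 = 729\<close>
      exceeds every byte.\<close>
    have "3 ^ j \<le> n"
      using d n(1) by auto
    also have "n < 3 ^ 6"
      using unat_byte_less[of b] n(2) by simp
    finally have "j < 6"
      by (rule power_less_imp_less_exp[rotated]) simp
    then have "j \<in> {0, 1, 2, 3, 4, 5}"
      by auto
    \<comment> \<open>Among the remaining candidates this removes
      \<open>2 * 3 ^ 5 = 486\<close>.\<close>
    moreover have "n < 256"
      using unat_byte_less[of b] n(2) by simp
    ultimately show "n \<in> ?N"
      using d n(1) by auto
  next
    fix n assume n: "n \<in> ?N"
    then have "n = 1 * 3 ^ 0 \<or> n = 1 * 3 ^ 1 \<or> n = 1 * 3 ^ 2 \<or> n = 1 * 3 ^ 3 \<or> n = 1 * 3 ^ 4 \<or>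
      n = 1 * 3 ^ 5 \<or> n = 2 * 3 ^ 0 \<or> n = 2 * 3 ^ 1 \<or> n = 2 * 3 ^ 2 \<or> n = 2 * 3 ^ 3 \<or> n = 2 * 3 ^ 4"
      by auto
    then have "\<exists>d\<in>{1, 2}. \<exists>j. n = d * 3 ^ j"
      by blast
    moreover have "n < 256"
      using n by auto
    then have u: "unat (of_nat n :: byte) = n"
      by (simp add: unat_of_nat)
    moreover have "(of_nat n :: byte) \<noteq> 0"
      using u n by (metis (no_types) unat_0 insert_iff empty_iff zero_neq_numeral zero_neq_one)
    ultimately show "n \<in> unat ` ?S"
      by (intro image_eqI[of _ _ "of_nat n"]) simp_all
  qed
  moreover have "card (unat ` ?S) = card ?S"
    by (intro card_image inj_onI) (rule unsigned_word_eqI)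
  moreover have "card ?N = 11"
    by simp
  ultimately show ?thesis
    by simp
qed

lemma splittable_bytes_card:
  "card {b :: byte. b \<noteq> 0 \<and> \<not> (\<exists>d\<in>{1, 2}. \<exists>j. unat b = d * 3 ^ j)} = 244"
proof -
  let ?P = "\<lambda>b :: byte. \<exists>d\<in>{1, 2}. \<exists>j. unat b = d * 3 ^ j"
  have "{b. b \<noteq> 0 \<and> \<not> ?P b} = {b. b \<noteq> 0} - {b. b \<noteq> 0 \<and> ?P b}"
    by blast
  moreover have "card \<dots> = card {b :: byte. b \<noteq> 0} - card {b. b \<noteq> 0 \<and> ?P b}"
    by (rule card_Diff_subset) auto
  ultimately show ?thesis
    by (simp only: nonzero_bytes_card unsplittable_bytes_card)
qed

section \<open>Commuting bytes and multicollisions\<close>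

text \<open>The ternary repunits \<open>(3 ^ k - 1) / 2\<close> for k = 1, 2, 4, 5. Their codewords
  are powers of the single symbol 2 and hence commute under concatenation.\<close>

lemma base3_1: "base3 1 = [1]"
  and base3_4: "base3 4 = [1, 1]"
  and base3_40: "base3 40 = [1, 1, 1, 1]"
  and base3_121: "base3 121 = [1, 1, 1, 1, 1]"
  by (simp_all add: base3.simps)

lemma codeword_1: "codeword C0 0x01 = [2]"
  and codeword_4: "codeword C0 0x04 = [2, 2]"
  and codeword_40: "codeword C0 0x28 = [2, 2, 2, 2]"
  and codeword_121: "codeword C0 0x79 = [2, 2, 2, 2, 2]"
  using base3_1 by (simp_all add: codeword_def base3_4 base3_40 base3_121)

lemmas codeword_all_ones = codeword_1 codeword_4 codeword_40 codeword_121

text \<open>All blocks have length 2, so a message determines its sequence of blocks, and there are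
  two choices for each block.\<close>

lemma card_swap_messages: "card (swap_messages r) = 2 ^ r"
proof -
  let ?A = "{[0x28, 0x79], [0x79, 0x28]} :: byte list set"
  let ?B = "{ps. length ps = r \<and> set ps \<subseteq> ?A}"
  have "inj_on concat ?B"
  proof (rule inj_onI)
    fix ps qs assume "ps \<in> ?B" "qs \<in> ?B" "concat ps = concat qs"
    \<comment> \<open>Injectivity of \<open>concat\<close> requires that corresponding blocks have
      equal length.\<close>
    moreover from this have "\<forall>(x, y)\<in>set (zip ps qs). length x = length y"
      by (fastforce dest: set_zip_leftD set_zip_rightD)
    ultimately show "ps = qs"
      by (intro concat_injective) auto
  qed
  then have "card (swap_messages r) = card ?B"
    by (simp add: swap_messages_def card_image)
  also have "?B = {ps. set ps \<subseteq> ?A \<and> length ps = r}"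
    by blast
  also have "card \<dots> = card ?A ^ r"
    by (rule card_lists_length_eq) simp
  also have "card ?A = 2"
    by simp
  finally show ?thesis .
qed

text \<open>In either order a block contributes two bytes and 4 + 5 = 9 symbols 2, so the encoding
  depends only on the number of blocks.\<close>

lemma swap_messages_length_encode:
  assumes "M \<in> swap_messages r"
  shows "length M = 2 * r" "encode C0 M = replicate (9 * r) 2"
proof -
  obtain ps where ps: "M = concat ps" "length ps = r" "set ps \<subseteq> {[0x28, 0x79], [0x79, 0x28]}"
    using assms by (auto simp: swap_messages_def)
  have "length (concat ps) = 2 * length ps \<and>
    encode C0 (concat ps) = replicate (9 * length ps) 2"
    using ps(3)
    by (induction ps) (auto simp: encode_Cons codeword_all_ones eval_nat_numeral)
  then show "length M = 2 * r" "encode C0 M = replicate (9 * r) 2"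
    using ps by simp_all
qed

theorem mainTheorem3:
  fixes C0 :: "nat list" and \<Phi> :: "nat list \<Rightarrow> 'd"
  assumes "set C0 \<subseteq> {1, 2, 3}"
  shows
    "(encode C0 [0x01, 0x04] = encode C0 [0x04, 0x01] \<and>
      encode C0 [0x28, 0x79] = encode C0 [0x79, 0x28] \<and>
      encode C0 [0x79, 0x28] = replicate 9 2 \<and>
      \<not> inj (encode C0) \<and>
      (\<exists>n. \<not> inj_on (encode C0) {M. length M = n}) \<and>
      (\<Phi> \<circ> encode C0) [0x01, 0x04] = (\<Phi> \<circ> encode C0) [0x04, 0x01] \<and>
      (\<Phi> \<circ> encode C0) [0x28, 0x79] = (\<Phi> \<circ> encode C0) [0x79, 0x28])
     \<and>
     encode C0 [0x01, 0x01] = encode C0 [0x04]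
     \<and>
     ((\<forall>b::byte. b \<noteq> 0 \<longrightarrow>
         ((\<exists>b1 b2. b1 \<noteq> 0 \<and> b2 \<noteq> 0 \<and> encode C0 [b1, b2] = encode C0 [b]) \<longleftrightarrow>
          \<not> (\<exists>d\<in>{1, 2}. \<exists>j. unat b = d * 3 ^ j))) \<and>
      card {b::byte. b \<noteq> 0} = 255 \<and>
      card {b::byte. b \<noteq> 0 \<and> (\<exists>d\<in>{1, 2}. \<exists>j. unat b = d * 3 ^ j)} = 11 \<and>
      card {b::byte. b \<noteq> 0 \<and>
              (\<exists>b1 b2. b1 \<noteq> 0 \<and> b2 \<noteq> 0 \<and> encode C0 [b1, b2] = encode C0 [b] \<and>
                 second_preimage (\<Phi> \<circ> encode C0) [b] [b1, b2])} = 244)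
     \<and>
     (\<forall>r\<ge>1.
        card (swap_messages r) = 2 ^ r \<and>
        (\<forall>M\<in>swap_messages r. length M = 2 * r) \<and>
        (\<forall>M\<in>swap_messages r. \<forall>M'\<in>swap_messages r.
           encode C0 M = encode C0 M' \<and> (\<Phi> \<circ> encode C0) M = (\<Phi> \<circ> encode C0) M'))
     \<and>
     (\<forall>M0 M1. encode C0 M0 = encode C0 M1 \<longrightarrow>
        (\<forall>P T. (\<Phi> \<circ> encode C0) (P @ T @ M0) = (\<Phi> \<circ> encode C0) (P @ T @ M1)))"
proof (intro conjI)
  show c1: "encode C0 [0x01, 0x04] = encode C0 [0x04, 0x01]"
    and c2: "encode C0 [0x28, 0x79] = encode C0 [0x79, 0x28]"
    and "encode C0 [0x79, 0x28] = replicate 9 2"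
    and "encode C0 [0x01, 0x01] = encode C0 [0x04]"
    by (simp_all add: encode_Cons codeword_all_ones eval_nat_numeral)
  then show "(\<Phi> \<circ> encode C0) [0x01, 0x04] = (\<Phi> \<circ> encode C0) [0x04, 0x01]"
    and "(\<Phi> \<circ> encode C0) [0x28, 0x79] = (\<Phi> \<circ> encode C0) [0x79, 0x28]"
    by simp_all
  \<comment> \<open>Length 2 is the witness; non-injectivity on this set passes to the set of all
    messages.\<close>
  have "\<not> inj_on (encode C0) {M. length M = 2}"
    using inj_onD[of "encode C0" "{M. length M = 2}" "[0x01, 0x04]" "[0x04, 0x01]"] c1 by auto
  then show "\<exists>n. \<not> inj_on (encode C0) {M. length M = n}" "\<not> inj (encode C0)"
    by (blast intro: inj_on_subset)+
  show "\<forall>b::byte. b \<noteq> 0 \<longrightarrow>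
      ((\<exists>b1 b2. b1 \<noteq> 0 \<and> b2 \<noteq> 0 \<and> encode C0 [b1, b2] = encode C0 [b]) \<longleftrightarrow>
       \<not> (\<exists>d\<in>{1, 2}. \<exists>j. unat b = d * 3 ^ j))"
    using encode_split_iff by blast
  \<comment> \<open>\<open>[b1, b2]\<close> and \<open>[b]\<close> differ in length, and equal
    encodings have equal images under every \<open>\<Phi>\<close>; so every such encoding collision
    is a second preimage.\<close>
  have "{b::byte. b \<noteq> 0 \<and> (\<exists>b1 b2. b1 \<noteq> 0 \<and> b2 \<noteq> 0 \<and> encode C0 [b1, b2] = encode C0 [b] \<and>
        second_preimage (\<Phi> \<circ> encode C0) [b] [b1, b2])} =
      {b. b \<noteq> 0 \<and> (\<exists>b1 b2. b1 \<noteq> 0 \<and> b2 \<noteq> 0 \<and> encode C0 [b1, b2] = encode C0 [b])}"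
    by (intro Collect_cong conj_cong ex_cong1) (auto simp: second_preimage_def)
  also have "\<dots> = {b. b \<noteq> 0 \<and> \<not> (\<exists>d\<in>{1, 2}. \<exists>j. unat b = d * 3 ^ j)}"
    using encode_split_iff by blast
  finally show "card {b::byte. b \<noteq> 0 \<and>
      (\<exists>b1 b2. b1 \<noteq> 0 \<and> b2 \<noteq> 0 \<and> encode C0 [b1, b2] = encode C0 [b] \<and>
        second_preimage (\<Phi> \<circ> encode C0) [b] [b1, b2])} = 244"
    using splittable_bytes_card by simp
\<comment> \<open>Among the remaining goals, a common prefix preserves a collision because
  \<open>encode\<close> turns concatenation of messages into concatenation of strings.\<close>
qed (use nonzero_bytes_card unsplittable_bytes_card in
    \<open>auto simp: card_swap_messages swap_messages_length_encode\<close>)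

end
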